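(* For every $\delta\in(0,\tfrac12)$, Algorithm R for the Online Simple Knapsack problem with item size estimates and additive accuracy $\delta$ has competitive ratio $\frac{1}{\min(p,q)}$ (i.e., $\mathrm{OPT}/\mathrm{ALG}\le \frac{1}{\min(p,q)}$ on every instance with accuracy $\delta$).
   Context: Problem: actual item sizes $x_1,\dots,x_n\in[0,1]$ and estimates $x_1',\dots,x_n'$ with $x_i'-\delta\le x_i\le x_i'+\delta$; the algorithm knows $\delta$ and all estimates in advance, the actual sizes are revealed one by one, and each item must be irrevocably packed (only if it fits into the remaining capacity of a knapsack of capacity $1$) or rejected. $\mathrm{ALG}$ is the total packed size, $\mathrm{OPT}$ the maximum total size of a subset of actual items with sum at most $1$; the competitive ratio is the supremum of $\mathrm{OPT}/\mathrm{ALG}$ over all instances. Write $k_1=\lfloor \frac{2}{1-2\delta}\rfloor$, $k_2=\lceil \frac{2}{1-2\delta}\rceil$, $p=-\frac{1}{2k_1}+\sqrt{\frac{1}{4k_1^2}+\frac{1-2\delta}{k_1}}$, $q=1-2\delta-\frac1{k_2}$, $c'=\min(p,q)$. Algorithm R: (1) If some item $x$ has estimate $x'\ge c'+\delta$, pack only $x$ (reject everything else) and stop. (2) Otherwise, if all estimates are at most $1-c'-\delta$, pack greedily (pack each item iff it fits). (3) Otherwise let $x_l$ be the last item with $x_l'\in(1-c'-\delta,c'+\delta)$ and set greedy := false. For each arriving item $y$ in order: if $y$ is $x_l$, set greedy := true; let $m$ be the total size packed so far; if greedy, pack $y$ if it fits; else if $m\in[c'-(x_l'-\delta),\,1-(x_l'+\delta)]$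 or $y+m\in(1-(x_l'+\delta),\,c')$, reject $y$; else pack $y$ if it fits. *)

theory Defs
  imports "HOL-Library.Extended_Real"
begin

definition k1 :: "real \<Rightarrow> int" where
  "k1 \<delta> = \<lfloor>2 / (1 - 2 * \<delta>)\<rfloor>"

definition k2 :: "real \<Rightarrow> int" where
  "k2 \<delta> = \<lceil>2 / (1 - 2 * \<delta>)\<rceil>"

definition p_val :: "real \<Rightarrow> real" where
  "p_val \<delta> = - (1 / (2 * of_int (k1 \<delta>)))
     + sqrt (1 / (4 * (of_int (k1 \<delta>))\<^sup>2) + (1 - 2 * \<delta>) / of_int (k1 \<delta>))"

definition q_val :: "real \<Rightarrow> real" where
  "q_val \<delta> = 1 - 2 * \<delta> - 1 / of_int (k2 \<delta>)"

definition c_val :: "real \<Rightarrow> real" where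
  "c_val \<delta> = min (p_val \<delta>) (q_val \<delta>)"

text \<open>An instance is a pair of lists: the estimates and the actual sizes, in order of
  arrival. The estimates are not required to lie in the unit interval.\<close>

definition instances :: "real \<Rightarrow> (real list \<times> real list) set" where
  "instances \<delta> = {(es, xs). length es = length xs \<and>
     (\<forall>i < length xs. 0 \<le> xs ! i \<and> xs ! i \<le> 1 \<and>
        es ! i - \<delta> \<le> xs ! i \<and> xs ! i \<le> es ! i + \<delta>)}"

definition opt :: "real list \<Rightarrow> real" where
  "opt xs = Max {(\<Sum>i\<in>S. xs ! i) |S. S \<subseteq> {..<length xs} \<and> (\<Sum>i\<in>S. xs ! i) \<le> 1}"

text \<open>The division is the one on extended reals: the quotient is infinite if the
  algorithm packs total size 0 while the optimum is positive, and it is 0 if both are 0,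
  so that instances with optimum 0 do not affect the supremum.\<close>

definition ratio :: "(real list \<Rightarrow> real list \<Rightarrow> real) \<Rightarrow> real list \<Rightarrow> real list \<Rightarrow> ereal" where
  "ratio alg es xs = ereal (opt xs) / ereal (alg es xs)"

definition competitive_ratio :: "real \<Rightarrow> (real list \<Rightarrow> real list \<Rightarrow> real) \<Rightarrow> ereal" where
  "competitive_ratio \<delta> alg = (SUP (es, xs) \<in> instances \<delta>. ratio alg es xs)"

text \<open>The new total after offering an item of size \<open>y\<close> to a knapsack of capacity 1
  already filled up to \<open>m\<close>.\<close>

definition pack_if_fits :: "real \<Rightarrow> real \<Rightarrow> real" where
  "pack_if_fits m y = (if m + y \<le> 1 then m + y else m)"

definition greedy_total :: "real list \<Rightarrow> real" where
  "greedy_total xs = foldl pack_if_fits 0 xs"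

text \<open>The loop of the third case: \<open>l\<close> is the position of the distinguished item and \<open>e\<close>
  its estimate, \<open>g\<close> the greedy flag, \<open>i\<close> the position of the arriving item, and \<open>m\<close> the
  total packed so far. The result is the final total.\<close>

fun loop_total ::
  "real \<Rightarrow> real \<Rightarrow> nat \<Rightarrow> real \<Rightarrow> bool \<Rightarrow> nat \<Rightarrow> real \<Rightarrow> real list \<Rightarrow> real" where
  "loop_total c \<delta> l e g i m [] = m"
| "loop_total c \<delta> l e g i m (y # ys) =
     (let g' = (g \<or> i = l);
          m' = (if g' then pack_if_fits m y
                else if m \<in> {c - (e - \<delta>) .. 1 - (e + \<delta>)} \<or> y + m \<in> {1 - (e + \<delta>) <..< c} then m
                else pack_if_fits m y)
      in loop_total c \<delta> l e g' (Suc i) m' ys)"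

definition last_middle :: "real \<Rightarrow> real list \<Rightarrow> nat" where
  "last_middle \<delta> es = Max {i. i < length es \<and>
     es ! i \<in> {1 - c_val \<delta> - \<delta> <..< c_val \<delta> + \<delta>}}"

text \<open>In its first case the algorithm packs an arbitrary item whose estimate is large
  enough. The rule \<open>sel\<close> picking the position of that item from the estimates is a
  parameter of the algorithm, constrained only as follows.\<close>

definition valid_selection :: "real \<Rightarrow> (real list \<Rightarrow> nat) \<Rightarrow> bool" where
  "valid_selection \<delta> sel \<longleftrightarrow>
     (\<forall>es. (\<exists>e \<in> set es. e \<ge> c_val \<delta> + \<delta>) \<longrightarrow>
        sel es < length es \<and> es ! sel es \<ge> c_val \<delta> + \<delta>)"

text \<open>The total size packed by Algorithm R. The single item packed in the first case has
  size at most 1, so it always fits.\<close>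

definition alg_R :: "real \<Rightarrow> (real list \<Rightarrow> nat) \<Rightarrow> real list \<Rightarrow> real list \<Rightarrow> real" where
  "alg_R \<delta> sel es xs =
     (if \<exists>e \<in> set es. e \<ge> c_val \<delta> + \<delta> then xs ! sel es
      else if \<forall>e \<in> set es. e \<le> 1 - c_val \<delta> - \<delta> then greedy_total xs
      else let l = last_middle \<delta> es
           in loop_total (c_val \<delta>) \<delta> l (es ! l) False 0 0 xs)"

end

theory Submission imports Defs begin

text \<open>
  Write \<open>w = 1 - 2\<delta>\<close> and \<open>c = min p q\<close>. If the algorithm packs less than \<open>c\<close> and still rejects
  something, it is in the loop, has packed the distinguished item \<open>x\<^sub>l > w - c\<close>, and all the rejected
  items have sizes in \<open>(w - c, c)\<close>. Since \<open>c \<le> q\<close>, a packing contains at most \<open>k\<^sub>1\<close> items larger than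
  \<open>w - c\<close>; it thus gains at most \<open>k\<^sub>1\<close> rejected items and then lacks \<open>x\<^sub>l\<close>, or at most
  \<open>k\<^sub>1 - 1\<close> of them. As \<open>c \<le> p\<close> means \<open>k\<^sub>1 c\<^sup>2 \<le> w - c\<close>, either gain is paid for by the factor \<open>1 / c\<close>.
  The bound is attained by two items of sizes \<open>c\<close> and \<open>1 - c\<close> of which the algorithm packs only the former.
\<close>

section \<open>Bounds on the constant \<open>c_val\<close>\<close>

text \<open>For \<open>p_val\<close>, squaring leaves only \<open>k * w \<le> 2\<close>, which the
  floor in \<open>k1\<close> provides; for \<open>q_val\<close>, the ceiling in \<open>k2\<close>
  makes \<open>1 / k2\<close> at most \<open>w / 2\<close>. Besides positivity of
  \<open>c_val\<close>, this settles a tie of estimates in the instance attaining the bound.\<close>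

lemma c_val_ge_half:
  assumes "0 < \<delta>" "\<delta> < 1 / 2"
  shows "(1 - 2 * \<delta>) / 2 \<le> c_val \<delta>"
proof -
  define w where "w = 1 - 2 * \<delta>"
  have w: "0 < w" "w < 1" using assms by (auto simp: w_def)
  define k where "k = real_of_int (k1 \<delta>)"
  have k_le: "k \<le> 2 / w" unfolding k_def k1_def w_def by linarith
  have "2 \<le> 2 / w" using w by (simp add: field_simps)
  then have k2: "2 \<le> k" unfolding k_def k1_def w_def by (simp add: le_floor_iff)
  have kw: "k * w \<le> 2" using k_le w by (simp add: field_simps)
  have "w / 2 + 1 / (2 * k) \<le> sqrt (1 / (4 * k\<^sup>2) + w / k)"
  proof (rule real_le_rsqrt)
    have "(w / 2 + 1 / (2 * k))\<^sup>2 = w * (k * w) / (4 * k) + w / (2 * k) + 1 / (4 * k\<^sup>2)"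
      using k2 by (simp add: power2_eq_square field_simps)
    also have "w * (k * w) / (4 * k) \<le> w * 2 / (4 * k)"
      using kw k2 w by (intro divide_right_mono mult_left_mono) auto
    finally show "(w / 2 + 1 / (2 * k))\<^sup>2 \<le> 1 / (4 * k\<^sup>2) + w / k"
      using k2 by (simp add: field_simps)
  qed
  then have p: "w / 2 \<le> p_val \<delta>"
    unfolding p_val_def k_def w_def by linarith
  have "2 / w \<le> real_of_int (k2 \<delta>)" unfolding k2_def w_def by linarith
  moreover have "0 < 2 / w" using w by simp
  ultimately have "1 / real_of_int (k2 \<delta>) \<le> 1 / (2 / w)" by (intro frac_le) auto
  then have "w / 2 \<le> q_val \<delta>" unfolding q_val_def w_def by simp
  with p show ?thesis by (simp add: c_val_def w_def)
qed

text \<open>Already \<open>q_val\<close> is this small: \<open>k2 < 2 / w + 1 \<le> 3 / w\<close>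
  because \<open>w < 1\<close>. The factor 3 is what guarantees room in the knapsack before the
  distinguished item arrives.\<close>

lemma c_val_le_two_thirds:
  assumes "0 < \<delta>" "\<delta> < 1 / 2"
  shows "3 * c_val \<delta> \<le> 2 * (1 - 2 * \<delta>)"
proof -
  define w where "w = 1 - 2 * \<delta>"
  have w: "0 < w" "w < 1" using assms by (auto simp: w_def)
  have "real_of_int (k2 \<delta>) < 2 / w + 1" "2 / w \<le> real_of_int (k2 \<delta>)"
    unfolding k2_def w_def by linarith+
  moreover have "1 \<le> 1 / w" "2 / w + 1 / w = 3 / w" "0 < 2 / w" using w by (auto simp: field_simps)
  ultimately have "0 < real_of_int (k2 \<delta>)" "real_of_int (k2 \<delta>) \<le> 3 / w" by linarith+
  then have "w / 3 \<le> 1 / real_of_int (k2 \<delta>)" using w by (simp add: field_simps)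
  then have "3 * q_val \<delta> \<le> 2 * w" unfolding q_val_def w_def by simp
  then show ?thesis unfolding c_val_def w_def by linarith
qed

text \<open>\<open>p_val\<close> is the positive root of \<open>k * t\<^sup>2 + t = w\<close>, and
  \<open>c_val\<close> does not exceed it.\<close>

lemma k1_mult_c_val_square_le:
  assumes "0 < \<delta>" "\<delta> < 1 / 2"
  shows "of_int (k1 \<delta>) * (c_val \<delta>)\<^sup>2 \<le> 1 - 2 * \<delta> - c_val \<delta>"
proof -
  define w where "w = 1 - 2 * \<delta>"
  define c where "c = c_val \<delta>"
  define k where "k = real_of_int (k1 \<delta>)"
  have w: "0 < w" "w < 1" using assms by (auto simp: w_def)
  have "2 \<le> 2 / w" using w by (simp add: field_simps)
  then have k: "2 \<le> k" unfolding k_def k1_def w_def by (simp add: le_floor_iff)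
  have c: "0 < c" using c_val_ge_half[OF assms] w by (simp add: c_def w_def)
  have "c \<le> p_val \<delta>" by (simp add: c_def c_val_def)
  then have "c + 1 / (2 * k) \<le> sqrt (1 / (4 * k\<^sup>2) + w / k)"
    unfolding p_val_def k_def w_def by linarith
  then have "(c + 1 / (2 * k))\<^sup>2 \<le> (sqrt (1 / (4 * k\<^sup>2) + w / k))\<^sup>2"
    using c k by (intro power_mono) auto
  moreover have "(sqrt (1 / (4 * k\<^sup>2) + w / k))\<^sup>2 = 1 / (4 * k\<^sup>2) + w / k" using k w by simp
  moreover have "(c + 1 / (2 * k))\<^sup>2 = c\<^sup>2 + c / k + 1 / (4 * k\<^sup>2)"
    by (simp add: power2_sum power_divide power_mult_distrib)
  ultimately have "c\<^sup>2 + c / k \<le> w / k" by linarith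
  then have "k * (c\<^sup>2 + c / k) \<le> k * (w / k)" using k by (intro mult_left_mono) auto
  also have "k * (w / k) = w" using k by simp
  also have "k * (c\<^sup>2 + c / k) = k * c\<^sup>2 + c" using k by (simp add: distrib_left)
  finally show ?thesis by (simp add: c_def w_def k_def)
qed

text \<open>From \<open>c_val \<le> q_val\<close> each of the \<open>t\<close> summands is at least
  \<open>1 / k2\<close>, so \<open>t < k2\<close>; the strict inequality and
  \<open>k2 \<le> k1 + 1\<close> then give \<open>k1\<close>.\<close>

lemma card_le_k1:
  assumes "0 < \<delta>" "\<delta> < 1 / 2" and t: "real t * (1 - 2 * \<delta> - c_val \<delta>) < 1"
  shows "real t \<le> of_int (k1 \<delta>)"
proof -
  have "0 < 2 / (1 - 2 * \<delta>)" using assms by simp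
  then have k2: "0 < k2 \<delta>" unfolding k2_def by linarith
  have "c_val \<delta> \<le> q_val \<delta>" by (simp add: c_val_def)
  then have "1 / of_int (k2 \<delta>) \<le> 1 - 2 * \<delta> - c_val \<delta>" by (simp add: q_val_def)
  then have "real t * (1 / of_int (k2 \<delta>)) \<le> real t * (1 - 2 * \<delta> - c_val \<delta>)"
    by (intro mult_left_mono) auto
  with t have "real t * (1 / of_int (k2 \<delta>)) < 1" by linarith
  then have "real t < of_int (k2 \<delta>)" using k2 by (simp add: pos_divide_less_eq)
  then have "int t < k2 \<delta>" by linarith
  moreover have "k2 \<delta> \<le> k1 \<delta> + 1" unfolding k1_def k2_def by linarith
  ultimately show ?thesis by linarith
qed

section \<open>Totals of greedy packing and of the loop\<close>

lemma foldl_pack_ge: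
  assumes "\<forall>y\<in>set ys. 0 \<le> y"
  shows "m \<le> foldl pack_if_fits m ys"
  using assms
proof (induction ys arbitrary: m)
  case (Cons y ys)
  have "m \<le> pack_if_fits m y" using Cons.prems by (simp add: pack_if_fits_def)
  also have "\<dots> \<le> foldl pack_if_fits (pack_if_fits m y) ys" using Cons by simp
  finally show ?case by simp
qed simp

text \<open>An item of size at most \<open>1 - c\<close> fails to fit only when the total already
  exceeds \<open>c\<close>; without such a failure everything is packed.\<close>

lemma foldl_pack_small_items:
  assumes "\<forall>y\<in>set ys. 0 \<le> y \<and> y \<le> 1 - c"
  shows "c \<le> foldl pack_if_fits m ys \<or> foldl pack_if_fits m ys = m + sum_list ys"
  using assms
proof (induction ys arbitrary: m)
  case (Cons y ys)
  show ?case
  proof (cases "m + y \<le> 1")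
    case True
    then show ?thesis using Cons.IH[of "m + y"] Cons.prems by (simp add: pack_if_fits_def add.assoc)
  next
    case False
    then have "c \<le> m" using Cons.prems by auto
    also have "m \<le> foldl pack_if_fits m (y # ys)" using Cons.prems by (intro foldl_pack_ge) auto
    finally show ?thesis by blast
  qed
qed simp

lemma loop_total_greedy:
  "loop_total c \<delta> l e True i m ys = foldl pack_if_fits m ys"
  by (induction ys arbitrary: i m) auto

lemma loop_total_ge:
  assumes "\<forall>y\<in>set ys. 0 \<le> y"
  shows "m \<le> loop_total c \<delta> l e g i m ys"
  using assms
proof (induction ys arbitrary: g i m)
  case (Cons y ys)
  have IH: "m' \<le> loop_total c \<delta> l e g' (Suc i) m' ys" for g' m' using Cons by simp
  have "m \<le> pack_if_fits m y" using Cons.prems by (simp add: pack_if_fits_def)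
  then show ?case
    using IH order.trans[OF _ IH] by (auto simp: Let_def)
qed simp

text \<open>The interval is chosen so that every size within \<open>\<delta>\<close> of
  \<open>e\<close> both fits and lifts the total to \<open>c\<close>. Until then the loop rejects
  all items and keeps \<open>m\<close>.\<close>

lemma loop_total_waiting:
  assumes "l = i + length us" "m \<in> {c - (e - \<delta>) .. 1 - (e + \<delta>)}"
    and x: "e - \<delta> \<le> x" "x \<le> e + \<delta>" "0 \<le> x"
    and vs: "\<forall>y\<in>set vs. 0 \<le> y"
  shows "c \<le> loop_total c \<delta> l e False i m (us @ x # vs)"
  using assms(1)
proof (induction us arbitrary: i)
  case Nil
  have "c \<le> m + x" using assms by simp
  also have "\<dots> \<le> foldl pack_if_fits (m + x) vs" by (rule foldl_pack_ge[OF vs])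
  finally show ?case using Nil assms by (simp add: loop_total_greedy pack_if_fits_def)
next
  case (Cons y us)
  then show ?case using Cons.IH[of "Suc i"] assms(2) by simp
qed

text \<open>Below \<open>c\<close> no total lies above \<open>1 - (e + \<delta>)\<close>, and one in the interval
  \<open>[c - (e - \<delta>), 1 - (e + \<delta>)]\<close> is kept until the distinguished item lifts it to at least \<open>c\<close>.\<close>

lemma loop_total_cases:
  assumes "l = i + length us"
    and "\<forall>y\<in>set us. 0 \<le> y \<and> y \<le> c + 2 * \<delta>"
    and x: "e - \<delta> \<le> x" "x \<le> e + \<delta>" "0 \<le> x"
    and vs: "\<forall>y\<in>set vs. 0 \<le> y \<and> y \<le> 1 - c"
    and e: "1 - c - \<delta> < e"
    and c: "3 * c \<le> 2 * (1 - 2 * \<delta>)" "0 < c"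
    and "0 \<le> m" "m \<le> 1 - (e + \<delta>) \<or> c \<le> m"
  shows "c \<le> loop_total c \<delta> l e False i m (us @ x # vs) \<or>
    (\<exists>P. (\<forall>j. P j \<longrightarrow> j < length us \<and> 1 - 2 * \<delta> - c < us ! j \<and> us ! j < c) \<and>
      loop_total c \<delta> l e False i m (us @ x # vs) =
        m + (\<Sum>j < length (us @ x # vs). if P j then 0 else (us @ x # vs) ! j))"
  using assms(1,2,10,11)
proof (induction us arbitrary: i m)
  case Nil
  have sum: "sum_list (x # vs) = (\<Sum>j < length (x # vs). (x # vs) ! j)"
    by (simp only: sum_list_sum_nth atLeast0LessThan)
  have eq: "loop_total c \<delta> l e False i m ([] @ x # vs) = foldl pack_if_fits m (x # vs)"
    using Nil.prems by (simp add: loop_total_greedy)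
  show ?case
  proof (cases "c \<le> m")
    case True
    also have "m \<le> foldl pack_if_fits m (x # vs)" using x vs by (intro foldl_pack_ge) auto
    finally show ?thesis unfolding eq by blast
  next
    case False
    then have "m + x \<le> 1" using Nil.prems x by linarith
    then have "foldl pack_if_fits m (x # vs) = foldl pack_if_fits (m + x) vs"
      by (simp add: pack_if_fits_def)
    with foldl_pack_small_items[OF vs, of "m + x"]
    have "c \<le> foldl pack_if_fits m (x # vs) \<or>
        foldl pack_if_fits m (x # vs) = m + sum_list (x # vs)" by (simp add: add.assoc)
    then show ?thesis unfolding eq sum by (intro disj_forward[OF _ _ exI[of _ "\<lambda>_. False"]]) auto
  qed
next
  case (Cons y us)
  have y: "0 \<le> y" "y \<le> c + 2 * \<delta>" using Cons.prems by auto
  have nn: "\<forall>z\<in>set ((y # us) @ x # vs). 0 \<le> z" using Cons.prems x vs by auto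
  show ?case
  proof (cases "c \<le> m")
    case True
    with loop_total_ge[OF nn] show ?thesis by (meson order.trans)
  next
    case mc: False
    show ?thesis
    proof (cases "m \<in> {c - (e - \<delta>) .. 1 - (e + \<delta>)}")
      case True
      then show ?thesis using loop_total_waiting[OF Cons.prems(1) True x] vs by blast
    next
      case wait: False
      have i: "i \<noteq> l" "l = Suc i + length us" using Cons.prems(1) by auto
      have us: "\<forall>y\<in>set us. 0 \<le> y \<and> y \<le> c + 2 * \<delta>" using Cons.prems by auto
      have m: "m < c - (e - \<delta>)" "m \<le> 1 - (e + \<delta>)" using wait mc Cons.prems by auto
      \<comment> \<open>Since \<open>e > 1 - c - \<delta>\<close>, the sum is below
        \<open>3 * c - 1 + 4 * \<delta> \<le> 1\<close>. Hence \<open>y\<close> can only be rejected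
        by the rule \<open>?r\<close>, never for lack of room.\<close>
      have ym: "m + y \<le> 1" using m y e c(1)[unfolded right_diff_distrib] by linarith
      let ?r = "y + m \<in> {1 - (e + \<delta>) <..< c}"
      let ?m = "if ?r then m else m + y"
      have eq: "loop_total c \<delta> l e False i m ((y # us) @ x # vs) =
          loop_total c \<delta> l e False (Suc i) ?m (us @ x # vs)"
        using i wait ym by (auto simp: pack_if_fits_def)
      \<comment> \<open>The rule \<open>?r\<close> rejects precisely when the new total would land
        in the forbidden gap, so the invariant survives.\<close>
      have "0 \<le> ?m" "?m \<le> 1 - (e + \<delta>) \<or> c \<le> ?m" using m y Cons.prems by auto
      from Cons.IH[OF i(2) us this] show ?thesis
      proof (elim disjE exE conjE)
        fix P
        assume P: "\<forall>j. P j \<longrightarrow> j < length us \<and> 1 - 2 * \<delta> - c < us ! j \<and> us ! j < c"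
          and sum: "loop_total c \<delta> l e False (Suc i) ?m (us @ x # vs) =
            ?m + (\<Sum>j < length (us @ x # vs). if P j then 0 else (us @ x # vs) ! j)"
        have shift: "sum f {..<length ((y # us) @ x # vs)} =
            f 0 + (\<Sum>j < length (us @ x # vs). f (Suc j))" for f :: "nat \<Rightarrow> real"
          using sum.lessThan_Suc_shift[of f "length (us @ x # vs)"] by (simp del: length_append)
        \<comment> \<open>Lower bound: subtract \<open>m < c - (e - \<delta>)\<close> from
          \<open>y + m > 1 - (e + \<delta>)\<close>; here \<open>e\<close> cancels. Upper bound:
          \<open>m\<close> is nonnegative.\<close>
        have "1 - 2 * \<delta> - c < y \<and> y < c" if ?r using that m Cons.prems(3) by auto
        \<comment> \<open>\<open>case_nat ?r P\<close> puts the decision on \<open>y\<close> in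
          front of the rejected positions of the tail.\<close>
        then have "\<forall>j. case_nat ?r P j \<longrightarrow> j < length (y # us) \<and>
            1 - 2 * \<delta> - c < (y # us) ! j \<and> (y # us) ! j < c"
          using P by (auto split: nat.splits)
        moreover have "loop_total c \<delta> l e False i m ((y # us) @ x # vs) =
            m + (\<Sum>j < length ((y # us) @ x # vs).
              if case_nat ?r P j then 0 else ((y # us) @ x # vs) ! j)"
          unfolding eq sum shift by (simp del: length_append cong: if_cong)
        ultimately show ?thesis by blast
      qed (simp only: eq simp_thms)
    qed
  qed
qed

section \<open>Comparing a packing with the accepted items\<close>

text \<open>Here \<open>R\<close> is the rejected set, \<open>N - R\<close> the packed one and
  \<open>S\<close> a competing packing. The items of \<open>S\<close> in \<open>R\<close> contribute
  at most \<open>c\<close> each and number at most \<open>k\<close>, so \<open>c\<close> times their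
  total is at most \<open>k * c\<^sup>2 \<le> d < x l\<close>. How the rest of \<open>S\<close> is
  paid for depends on whether it contains \<open>l\<close>.\<close>

lemma mult_sum_le_of_large_rejected:
  fixes x :: "nat \<Rightarrow> real"
  assumes "finite N" "S \<subseteq> N" "l \<in> N" "l \<notin> R" "R \<subseteq> N"
    and nonneg: "\<And>i. i \<in> N \<Longrightarrow> 0 \<le> x i"
    and R: "\<And>i. i \<in> R \<Longrightarrow> d < x i \<and> x i \<le> c"
    and l: "d < x l" and A: "sum x (N - R) < c"
    and S: "sum x S \<le> 1"
    and k: "\<And>t. real t * d < 1 \<Longrightarrow> real t \<le> k" "k * c\<^sup>2 \<le> d"
    and c: "0 < c" "c \<le> 1"
  shows "c * sum x S \<le> sum x (N - R)"
proof -
  let ?A = "sum x (N - R)"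
  define T where "T = S \<inter> R"
  \<comment> \<open>Item \<open>l\<close> also exceeds \<open>d\<close>, so it counts towards the
    bound \<open>k\<close> whenever it belongs to \<open>S\<close>.\<close>
  define U where "U = S \<inter> insert l R"
  have fin: "finite S" "finite T" "finite U" "finite R"
    using assms(1,2,5) by (auto simp: T_def U_def intro: finite_subset)
  have "real (card U) * d < 1"
  proof (cases "U = {}")
    case False
    have "real (card U) * d = (\<Sum>i\<in>U. d)" by simp
    also have "\<dots> < sum x U"
      using False fin R l by (intro sum_strict_mono) (auto simp: U_def)
    also have "\<dots> \<le> sum x S"
      using fin nonneg assms(2) by (intro sum_mono2) (auto simp: U_def)
    finally show ?thesis using S by linarith
  qed simp
  then have U: "real (card U) \<le> k" by (rule k)
  have "sum x T \<le> (\<Sum>i\<in>T. c)" using R by (intro sum_mono) (auto simp: T_def)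
  then have T: "sum x T \<le> real (card T) * c" by simp
  have split: "sum x S = sum x (S - R) + sum x T"
    unfolding T_def using fin by (metis Int_Diff_Un Int_Diff_disjoint finite_Diff finite_Int
        sum.union_disjoint add.commute)
  have xl: "x l \<le> ?A" using assms(1,3,4) nonneg by (intro member_le_sum) auto
  show ?thesis
  proof (cases "l \<in> S")
    case True
    then have "U = insert l T" "l \<notin> T" using assms(4) by (auto simp: U_def T_def)
    \<comment> \<open>As \<open>l\<close> uses one of the \<open>k\<close> places, a slack of
      \<open>c\<^sup>2\<close> remains. It absorbs \<open>c * sum x (S - R)\<close>, because the
      packed total is below \<open>c\<close>; altogether at most \<open>d < x l\<close> is
      needed.\<close>
    then have "real (card T) + 1 \<le> k" using U fin by simp
    then have "real (card T) * c\<^sup>2 \<le> (k - 1) * c\<^sup>2" by (intro mult_right_mono) auto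
    then have "c * (real (card T) * c) \<le> d - c * c"
      using k(2) by (simp add: power2_eq_square algebra_simps)
    moreover have "c * sum x T \<le> c * (real (card T) * c)" using T c by (intro mult_left_mono) auto
    moreover have "sum x (S - R) \<le> ?A"
      using assms(1,2) nonneg by (intro sum_mono2) auto
    then have "c * sum x (S - R) \<le> c * c" using A c by (intro mult_left_mono) auto
    ultimately show ?thesis using xl l unfolding split by (simp add: distrib_left)
  next
    case False
    \<comment> \<open>All \<open>k\<close> places may go to rejected items, but \<open>S\<close>
      misses \<open>l\<close>: the part \<open>S - R\<close> costs at most \<open>?A - x l\<close>,
      which leaves \<open>x l > d\<close> for the rejected ones.\<close>
    then have "U = T" by (auto simp: U_def T_def)
    with U have "real (card T) * c\<^sup>2 \<le> k * c\<^sup>2" by (intro mult_right_mono) auto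
    then have "c * (real (card T) * c) \<le> d"
      using k(2) by (simp add: power2_eq_square algebra_simps)
    moreover have "c * sum x T \<le> c * (real (card T) * c)" using T c by (intro mult_left_mono) auto
    moreover have "sum x (S - R) \<le> sum x (N - R - {l})"
      using assms(1,2) False nonneg by (intro sum_mono2) auto
    then have "sum x (S - R) \<le> ?A - x l"
      using assms(1,3,4) by (simp add: sum_diff1)
    then have "c * sum x (S - R) \<le> c * (?A - x l)" using c by (intro mult_left_mono) auto
    moreover have "c * (?A - x l) \<le> 1 * (?A - x l)" using c xl by (intro mult_right_mono) auto
    ultimately show ?thesis using l unfolding split by (simp add: distrib_left)
  qed
qed

section \<open>Basic facts about the optimum\<close>

lemma finite_packings:
  "finite {(\<Sum>i\<in>S. xs ! i) |S. S \<subseteq> {..<length xs} \<and> (\<Sum>i\<in>S. xs ! i) \<le> (1 :: real)}"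
  by (rule finite_subset[of _ "(\<lambda>S. \<Sum>i\<in>S. xs ! i) ` Pow {..<length xs}"]) auto

lemma opt_ge:
  "S \<subseteq> {..<length xs} \<Longrightarrow> (\<Sum>i\<in>S. xs ! i) \<le> 1 \<Longrightarrow> (\<Sum>i\<in>S. xs ! i) \<le> opt xs"
  unfolding opt_def by (intro Max_ge finite_packings) blast

lemma opt_attained:
  obtains S where "S \<subseteq> {..<length xs}" "(\<Sum>i\<in>S. xs ! i) \<le> 1" "opt xs = (\<Sum>i\<in>S. xs ! i)"
proof -
  have "opt xs \<in> {(\<Sum>i\<in>S. xs ! i) |S. S \<subseteq> {..<length xs} \<and> (\<Sum>i\<in>S. xs ! i) \<le> 1}"
    unfolding opt_def by (rule Max_in[OF finite_packings]) (auto intro!: exI[of _ "{}"])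
  then show thesis using that by blast
qed

lemma opt_le_one: "opt xs \<le> 1"
  by (rule opt_attained[of xs]) simp

lemma opt_nonneg: "0 \<le> opt xs"
  using opt_ge[of "{}" xs] by simp

lemma opt_le_sum_list:
  assumes "\<forall>x\<in>set xs. 0 \<le> x"
  shows "opt xs \<le> sum_list xs"
proof (rule opt_attained[of xs])
  fix S assume S: "S \<subseteq> {..<length xs}" "opt xs = (\<Sum>i\<in>S. xs ! i)"
  have "(\<Sum>i\<in>S. xs ! i) \<le> (\<Sum>i<length xs. xs ! i)"
    using S assms by (intro sum_mono2) auto
  with S show ?thesis by (simp add: sum_list_sum_nth atLeast0LessThan)
qed

section \<open>Lower bound on the total packed by the algorithm\<close>

text \<open>A total of at least \<open>c\<close> suffices because the optimum is at most 1.
  Otherwise the loop analysis yields the rejected positions \<open>P\<close>, and the comparison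
  applies with \<open>d = 1 - 2 * \<delta> - c\<close> and \<open>k = k1\<close>.\<close>

lemma loop_total_ge_opt:
  assumes \<delta>: "0 < \<delta>" "\<delta> < 1 / 2"
    and xs: "xs = us @ x # vs"
    and us: "\<forall>y\<in>set us. 0 \<le> y \<and> y \<le> c_val \<delta> + 2 * \<delta>"
    and x: "e - \<delta> \<le> x" "x \<le> e + \<delta>" "0 \<le> x"
    and vs: "\<forall>y\<in>set vs. 0 \<le> y \<and> y \<le> 1 - c_val \<delta>"
    and e: "1 - c_val \<delta> - \<delta> < e" "e < c_val \<delta> + \<delta>"
  shows "c_val \<delta> * opt xs \<le> loop_total (c_val \<delta>) \<delta> (length us) e False 0 0 xs"
proof -
  define c where "c = c_val \<delta>"
  define A where "A = loop_total c \<delta> (length us) e False 0 0 xs"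
  have c: "0 < c" "3 * c \<le> 2 * (1 - 2 * \<delta>)" "c \<le> 1"
    using c_val_ge_half[OF \<delta>] c_val_le_two_thirds[OF \<delta>] \<delta> by (auto simp: c_def)
  have le: "c * opt xs \<le> A" if "c \<le> A"
    using that c mult_left_mono[OF opt_le_one[of xs], of c] by linarith
  \<comment> \<open>The loop invariant at the initial total 0: \<open>e + \<delta> < c + 2 *
    \<delta> \<le> (2 + 2 * \<delta>) / 3 < 1\<close>.\<close>
  have "0 \<le> 1 - (e + \<delta>) \<or> c \<le> 0"
    using e c(2)[unfolded right_diff_distrib] \<delta> unfolding c_def by linarith
  then have loop: "c \<le> A \<or>
      (\<exists>P. (\<forall>j. P j \<longrightarrow> j < length us \<and> 1 - 2 * \<delta> - c < us ! j \<and> us ! j < c) \<and>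
        A = 0 + (\<Sum>j < length xs. if P j then 0 else xs ! j))"
    unfolding A_def xs using us x vs e c by (intro loop_total_cases) (auto simp: c_def)
  have "c * opt xs \<le> A"
  proof (cases "c \<le> A")
    case True
    then show ?thesis by (rule le)
  next
    case False
    with loop obtain P where P: "\<forall>j. P j \<longrightarrow> j < length us \<and> 1 - 2 * \<delta> - c < us ! j \<and> us ! j < c"
      and sum: "A = (\<Sum>j < length xs. if P j then 0 else xs ! j)"
      by auto
    have nonneg: "\<forall>y\<in>set xs. 0 \<le> y" using us x vs xs by auto
    let ?N = "{..<length xs}"
    have A: "A = sum ((!) xs) (?N - Collect P)"
      unfolding sum by (rule sum.mono_neutral_cong_right) auto
    obtain S where S: "S \<subseteq> ?N" "(\<Sum>i\<in>S. xs ! i) \<le> 1" "opt xs = (\<Sum>i\<in>S. xs ! i)"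
      by (rule opt_attained)
    have "c * sum ((!) xs) S \<le> sum ((!) xs) (?N - Collect P)"
    proof (rule mult_sum_le_of_large_rejected[of _ _ "length us" _ _ "1 - 2 * \<delta> - c" _ "of_int (k1 \<delta>)"])
      show "length us \<in> ?N" by (simp add: xs)
      show "0 \<le> xs ! i" if "i \<in> ?N" for i using that nonneg by simp
      show "length us \<notin> Collect P" using P by auto
      show "Collect P \<subseteq> ?N" using P by (auto simp: xs)
      show "1 - 2 * \<delta> - c < xs ! i \<and> xs ! i \<le> c" if "i \<in> Collect P" for i
        using P that by (auto simp: xs nth_append less_imp_le)
      show "1 - 2 * \<delta> - c < xs ! length us" using x e by (simp add: xs c_def)
      show "real t \<le> of_int (k1 \<delta>)" if "real t * (1 - 2 * \<delta> - c) < 1" for t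
        using card_le_k1[OF \<delta>] that by (simp add: c_def)
      show "of_int (k1 \<delta>) * c\<^sup>2 \<le> 1 - 2 * \<delta> - c"
        using k1_mult_c_val_square_le[OF \<delta>] by (simp add: c_def)
    qed (use S False A c in auto)
    then show ?thesis by (simp add: S(3) A)
  qed
  then show ?thesis by (simp add: A_def c_def)
qed

text \<open>A large estimate guarantees an item of size \<open>c\<close>. If all estimates are
  small, greedy packing reaches \<open>c\<close> or takes everything. The remaining case is the
  loop, split at the distinguished item.\<close>

lemma alg_R_ge_opt:
  assumes \<delta>: "0 < \<delta>" "\<delta> < 1 / 2" and sel: "valid_selection \<delta> sel"
    and inst: "(es, xs) \<in> instances \<delta>"
  shows "c_val \<delta> * opt xs \<le> alg_R \<delta> sel es xs"
proof -
  define c where "c = c_val \<delta>"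
  have c: "0 < c" "c \<le> 1"
    using c_val_ge_half[OF \<delta>] c_val_le_two_thirds[OF \<delta>] \<delta> by (auto simp: c_def)
  have len: "length es = length xs"
    and acc: "\<And>i. i < length xs \<Longrightarrow>
      0 \<le> xs ! i \<and> xs ! i \<le> 1 \<and> es ! i - \<delta> \<le> xs ! i \<and> xs ! i \<le> es ! i + \<delta>"
    using inst by (auto simp: instances_def)
  have le: "c * opt xs \<le> a" if "c \<le> a" for a
    using that c mult_left_mono[OF opt_le_one[of xs], of c] by linarith
  consider (big) "\<exists>e\<in>set es. c + \<delta> \<le> e"
    | (small) "\<not> (\<exists>e\<in>set es. c + \<delta> \<le> e)" "\<forall>e\<in>set es. e \<le> 1 - c - \<delta>"
    | (middle) "\<not> (\<exists>e\<in>set es. c + \<delta> \<le> e)" "\<not> (\<forall>e\<in>set es. e \<le> 1 - c - \<delta>)"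
    by blast
  then have "c * opt xs \<le> alg_R \<delta> sel es xs"
  proof cases
    case big
    then have "sel es < length es" "c + \<delta> \<le> es ! sel es"
      using sel by (auto simp: valid_selection_def c_def)
    then have "c \<le> xs ! sel es" using acc[of "sel es"] len by simp
    then show ?thesis using big by (simp add: alg_R_def c_def[symmetric] le)
  next
    case small
    have xs: "\<forall>x\<in>set xs. 0 \<le> x \<and> x \<le> 1 - c"
    proof
      fix x assume "x \<in> set xs"
      then obtain i where i: "i < length xs" "x = xs ! i" by (auto simp: in_set_conv_nth)
      then have "es ! i \<le> 1 - c - \<delta>" using small len by simp
      with acc[of i] i show "0 \<le> x \<and> x \<le> 1 - c" by simp
    qed
    have "opt xs \<le> sum_list xs" using xs by (intro opt_le_sum_list) simp
    moreover have "c * opt xs \<le> opt xs"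
      using c opt_nonneg[of xs] by (simp add: mult_left_le_one_le)
    ultimately have "c * opt xs \<le> greedy_total xs"
      using foldl_pack_small_items[OF xs, of 0] le by (auto simp: greedy_total_def)
    then show ?thesis using small by (simp add: alg_R_def c_def[symmetric])
  next
    case middle
    define M where "M = {i. i < length es \<and> es ! i \<in> {1 - c - \<delta> <..< c + \<delta>}}"
    define l where "l = Max M"
    have small: "es ! i < c + \<delta>" if "i < length xs" for i
      using middle(1) that len by (metis not_le nth_mem)
    have "finite M" by (simp add: M_def)
    moreover from middle obtain i where "i < length es" "\<not> es ! i \<le> 1 - c - \<delta>"
      by (auto simp: in_set_conv_nth)
    then have "i \<in> M" using small len by (auto simp: M_def)
    then have "M \<noteq> {}" by blast
    ultimately have "l \<in> M" and max: "\<And>i. i \<in> M \<Longrightarrow> i \<le> l" by (auto simp: l_def)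
    then have l: "l < length xs" "1 - c - \<delta> < es ! l" "es ! l < c + \<delta>"
      using len by (auto simp: M_def)
    have "c * opt xs \<le> loop_total c \<delta> (length (take l xs)) (es ! l) False 0 0 xs"
      unfolding c_def
    proof (rule loop_total_ge_opt[OF \<delta> id_take_nth_drop[OF l(1)]])
      show "\<forall>y\<in>set (take l xs). 0 \<le> y \<and> y \<le> c_val \<delta> + 2 * \<delta>"
      proof
        fix y assume "y \<in> set (take l xs)"
        then obtain i where i: "i < length xs" "y = xs ! i" by (auto simp: in_set_conv_nth)
        with acc[of i] small[of i] show "0 \<le> y \<and> y \<le> c_val \<delta> + 2 * \<delta>" by (simp add: c_def)
      qed
      show "\<forall>y\<in>set (drop (Suc l) xs). 0 \<le> y \<and> y \<le> 1 - c_val \<delta>"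
      proof
        fix y assume "y \<in> set (drop (Suc l) xs)"
        then obtain j where j: "j < length xs - Suc l" "y = drop (Suc l) xs ! j"
          by (auto simp: in_set_conv_nth)
        define i where "i = Suc l + j"
        have i: "l < i" "i < length xs" "y = xs ! i" using j by (auto simp: i_def)
        \<comment> \<open>By maximality of \<open>l\<close> no later estimate is in the middle
          range, and none is large, so each later size is at most \<open>1 - c\<close>.\<close>
        then have "i \<notin> M" using max[of i] by auto
        then have "es ! i \<le> 1 - c - \<delta>" using i small[of i] len by (auto simp: M_def)
        with acc[of i] i show "0 \<le> y \<and> y \<le> 1 - c_val \<delta>" by (simp add: c_def)
      qed
    qed (use acc[of l] l in \<open>auto simp: c_def\<close>)
    moreover have "last_middle \<delta> es = l"
      by (simp add: last_middle_def l_def M_def c_def)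
    ultimately show ?thesis
      unfolding alg_R_def Let_def c_def[symmetric] if_not_P[OF middle(1)] if_not_P[OF middle(2)]
      using l by simp
  qed
  then show ?thesis by (simp add: c_def)
qed

section \<open>The competitive ratio and its attainment\<close>

text \<open>If the algorithm packs 0, the hypothesis forces the optimum to be 0 as well, and the
  quotient is then 0 instead of infinite.\<close>

lemma ratio_le:
  assumes "0 < c" "c * opt xs \<le> alg es xs"
  shows "ratio alg es xs \<le> ereal (1 / c)"
proof (cases "alg es xs = 0")
  case True
  with assms have "opt xs \<le> 0" by (simp add: mult_le_0_iff)
  with opt_nonneg[of xs] have "opt xs = 0" by simp
  then show ?thesis using assms True by (simp add: ratio_def)
next
  case False
  have "0 \<le> c * opt xs" using assms opt_nonneg by simp
  with False assms have "0 < alg es xs" by linarith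
  then show ?thesis using assms by (simp add: ratio_def field_simps)
qed

text \<open>The rule \<open>sel\<close> may prefer the second item only if both have the same estimate, and then
  the two sizes can be exchanged.\<close>

lemma ratio_alg_R_attained:
  assumes \<delta>: "0 < \<delta>" "\<delta> < 1 / 2" and sel: "valid_selection \<delta> sel"
  obtains es xs where "(es, xs) \<in> instances \<delta>" "ereal (1 / c_val \<delta>) \<le> ratio (alg_R \<delta> sel) es xs"
proof -
  define c where "c = c_val \<delta>"
  have c: "0 < c" "c \<le> 1" "1 - 2 * \<delta> \<le> 2 * c" "c \<le> 1 - 2 * \<delta>"
    using c_val_ge_half[OF \<delta>] c_val_le_two_thirds[OF \<delta>] \<delta> by (auto simp: c_def)
  \<comment> \<open>The first estimate just reaches the threshold of the first case. The sizes
    \<open>c\<close> and \<open>1 - c\<close> are the extreme deviations down and up, and together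
    fill the knapsack exactly.\<close>
  define es where "es = [c + \<delta>, 1 - c - \<delta>]"
  have big: "\<exists>e\<in>set es. c_val \<delta> + \<delta> \<le> e" by (auto simp: es_def c_def)
  then have "sel es < length es \<and> c_val \<delta> + \<delta> \<le> es ! sel es"
    using sel by (simp only: valid_selection_def)
  then have s: "sel es < 2" "c + \<delta> \<le> es ! sel es" by (auto simp: c_def es_def)
  define xs where "xs = (if sel es = 0 then [c, 1 - c] else [1 - c, c])"
  have len2: "length xs = 2" by (simp add: xs_def)
  have xs_sum: "(\<Sum>i<2. xs ! i) = 1" by (simp add: xs_def numeral_2_eq_2)
  \<comment> \<open>Choosing position 1 needs \<open>c + \<delta> \<le> 1 - c - \<delta>\<close>,
    and \<open>1 - 2 * \<delta> \<le> 2 * c\<close> turns this into equality; so the exchanged sizes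
    still respect the accuracy.\<close>
  have swap: "1 - c = c + 2 * \<delta>" if "sel es \<noteq> 0"
  proof -
    have "sel es = 1" using s that by linarith
    with s c show ?thesis by (simp add: es_def)
  qed
  have "(es, xs) \<in> instances \<delta>"
    using c \<delta> swap by (auto simp: instances_def es_def xs_def less_Suc_eq)
  moreover have "alg_R \<delta> sel es xs = c"
    using big s by (auto simp: alg_R_def xs_def less_Suc_eq numeral_2_eq_2)
  moreover have "1 \<le> opt xs"
    using opt_ge[of "{..<2}" xs] by (simp add: xs_sum len2)
  ultimately show thesis
    using c by (intro that[of es xs]) (auto simp: ratio_def c_def[symmetric] divide_right_mono)
qed

theorem theorem15:
  fixes \<delta> :: real and sel :: "real list \<Rightarrow> nat"
  assumes "0 < \<delta>" and "\<delta> < 1 / 2"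
    and "valid_selection \<delta> sel"
  shows "(\<forall>(es, xs) \<in> instances \<delta>.
            ratio (alg_R \<delta> sel) es xs \<le> ereal (1 / min (p_val \<delta>) (q_val \<delta>)))
       \<and> competitive_ratio \<delta> (alg_R \<delta> sel) = ereal (1 / min (p_val \<delta>) (q_val \<delta>))"
proof -
  have "0 < c_val \<delta>" using c_val_ge_half[OF assms(1,2)] assms by simp
  then have upper: "\<forall>(es, xs) \<in> instances \<delta>. ratio (alg_R \<delta> sel) es xs \<le> ereal (1 / c_val \<delta>)"
    using alg_R_ge_opt[OF assms] by (auto intro: ratio_le)
  obtain es xs where "(es, xs) \<in> instances \<delta>"
      "ereal (1 / c_val \<delta>) \<le> ratio (alg_R \<delta> sel) es xs"
    by (rule ratio_alg_R_attained[OF assms])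
  then have "competitive_ratio \<delta> (alg_R \<delta> sel) = ereal (1 / c_val \<delta>)"
    unfolding competitive_ratio_def using upper
    by (intro antisym SUP_least SUP_upper2[of "(es, xs)"]) auto
  with upper show ?thesis by (simp add: c_val_def)
qed

end
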